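(* Let $n > t \ge 0$ be integers and let $X$ be any (finite or infinite) set with $|X| \ge 2$. Then the Helly number $h(n,t;X)$ of the family of all Hamming balls of radius $t$ in $X^n$ is exactly $2^{t+1}$.
   Context: For $p,q \in X^n$, the Hamming distance $\mathrm{dist}(p,q)$ is the number of coordinates in which $p$ and $q$ differ. The Hamming ball of radius $t$ centered at $x \in X^n$ is $B(x,t) = \{p \in X^n : \mathrm{dist}(p,x) \le t\}$. The Helly number $h(\mathcal{F})$ of a family $\mathcal{F}$ of sets is the smallest integer $h$ such that for every finite subfamily $\mathcal{K} \subseteq \mathcal{F}$, if every subfamily of at most $h$ members of $\mathcal{K}$ has nonempty intersection, then all members of $\mathcal{K}$ have a common point. $h(n,t;X)$ denotes the Helly number of the family of all Hamming balls of radius $t$ in $X^n$. *)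

theory Defs
  imports "HOL-Library.FuncSet" "HOL-Library.Extended_Nat"
begin

text \<open>
  Points of \<open>X\<^sup>n\<close> are the extensional functions \<open>{..<n} \<rightarrow>\<^sub>E X\<close>, so that two points are equal
  as functions exactly if they agree in all \<open>n\<close> coordinates.
\<close>

definition hamming_dist :: "nat \<Rightarrow> (nat \<Rightarrow> 'a) \<Rightarrow> (nat \<Rightarrow> 'a) \<Rightarrow> nat" where
  "hamming_dist n p q = card {i \<in> {..<n}. p i \<noteq> q i}"

definition hamming_ball :: "nat \<Rightarrow> 'a set \<Rightarrow> (nat \<Rightarrow> 'a) \<Rightarrow> nat \<Rightarrow> (nat \<Rightarrow> 'a) set" where
  "hamming_ball n X x t = {p \<in> {..<n} \<rightarrow>\<^sub>E X. hamming_dist n p x \<le> t}"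

text \<open>
  The intersection of the empty subfamily is \<open>UNIV\<close>, hence nonempty, so the empty choices of
  \<open>\<K>\<close> and \<open>\<G>\<close> impose nothing.
\<close>

definition helly_property :: "'b set set \<Rightarrow> nat \<Rightarrow> bool" where
  "helly_property \<F> h \<longleftrightarrow>
     (\<forall>\<K>. \<K> \<subseteq> \<F> \<and> finite \<K> \<longrightarrow>
        (\<forall>\<G>. \<G> \<subseteq> \<K> \<and> card \<G> \<le> h \<longrightarrow> \<Inter>\<G> \<noteq> {}) \<longrightarrow> \<Inter>\<K> \<noteq> {})"

text \<open>The value is \<open>\<infinity>\<close> if no \<open>h\<close> has the property; otherwise the infimum is attained.\<close>

definition helly_number :: "'b set set \<Rightarrow> enat" where
  "helly_number \<F> = Inf (enat ` {h. helly_property \<F> h})"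

definition hamming_helly_number :: "nat \<Rightarrow> nat \<Rightarrow> 'a set \<Rightarrow> enat" where
  "hamming_helly_number n t X =
     helly_number ((\<lambda>x. hamming_ball n X x t) ` ({..<n} \<rightarrow>\<^sub>E X))"

end

theory Submission
  imports Defs Complex_Main
begin

text \<open>
  A minimal family of balls around \<open>x i\<close> without a common point yields points \<open>y i\<close> such that
  \<open>x i\<close> and \<open>y j\<close> are at distance more than \<open>t\<close> exactly for \<open>i = j\<close>. Let \<open>E i\<close> be the set of
  coordinates in which \<open>x i\<close> and \<open>y i\<close> differ, give each coordinate a weight of at most
  \<open>M = 2 ^ n\<close>, and let \<open>W i\<close> be the space of multilinear polynomials spanned by the
  \<open>\<Prod>k\<in>A. (z k - x i k)\<close> with \<open>2 w(A \<inter> E i) > w(E i) + M t\<close>. For suitable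
  weights, \<open>W i\<close> has dimension at least \<open>2 ^ (n - t - 1)\<close>. The sum of the \<open>W i\<close> is direct: in a
  relation between them, let the term \<open>f\<close> of index \<open>j\<close> have the least weighted order of vanishing
  \<open>a\<close> at its point \<open>x j\<close>. The other terms, hence also \<open>f\<close>, vanish to order \<open>a - M t\<close> at \<open>y j\<close>,
  and such orders at both \<open>x j\<close> and \<open>y j\<close> force the part of \<open>f\<close> of order \<open>a\<close> to be zero. As
  all multilinear polynomials form a space of dimension \<open>2 ^ n\<close>, there are at most \<open>2 ^ (t + 1)\<close>
  balls. For the lower bound take the centers in \<open>{a, b} ^ (t + 1)\<close>, constant elsewhere.
\<close>

section \<open>Underdetermined linear systems\<close>

text \<open>Gaussian elimination: a nontrivial equation is solved for one unknown \<open>l\<close>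
  and eliminated from the others, which costs one unknown and one equation. This replaces the
  dimension count for spaces of polynomials.\<close>

lemma homogeneous_system_solution:
  fixes M :: "'j \<Rightarrow> 'k \<Rightarrow> 'f::field"
  assumes "finite K" "finite J" "card K < card J"
  shows "\<exists>u. (\<exists>j\<in>J. u j \<noteq> 0) \<and> (\<forall>k\<in>K. (\<Sum>j\<in>J. u j * M j k) = 0)"
  using assms
proof (induction K arbitrary: J M rule: finite_induct)
  case empty
  then have "J \<noteq> {}" by auto
  then show ?case by (intro exI[of _ "\<lambda>_. 1"]) auto
next
  case (insert k K)
  show ?case
  proof (cases "\<forall>j\<in>J. M j k = 0")
    case True
    from insert.prems insert.hyps have "card K < card J" by simp
    from insert.IH[OF insert.prems(1) this, of M] obtain u where
      "\<exists>j\<in>J. u j \<noteq> 0" "\<forall>k\<in>K. (\<Sum>j\<in>J. u j * M j k) = 0" by blast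
    with True show ?thesis by (intro exI[of _ u]) simp
  next
    case False
    then obtain l where l: "l \<in> J" "M l k \<noteq> 0" by blast
    let ?J = "J - {l}"
    let ?N = "\<lambda>j k'. M j k' - M j k / M l k * M l k'"
    have "card K < card ?J" "finite ?J" using insert.prems insert.hyps l by auto
    from insert.IH[OF this(2,1), of ?N] obtain u where u:
      "\<exists>j\<in>?J. u j \<noteq> 0" "\<forall>k'\<in>K. (\<Sum>j\<in>?J. u j * ?N j k') = 0" by blast
    \<comment> \<open>The value at \<open>l\<close> is the one that equation \<open>k\<close>
      forces.\<close>
    define v where "v = u(l := - (\<Sum>j\<in>?J. u j * (M j k / M l k)))"
    have split: "(\<Sum>j\<in>J. v j * M j k') = (\<Sum>j\<in>?J. u j * ?N j k')" for k'
    proof -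
      have "(\<Sum>j\<in>J. v j * M j k') = v l * M l k' + (\<Sum>j\<in>?J. v j * M j k')"
        using l insert.prems by (simp add: sum.remove)
      also have "(\<Sum>j\<in>?J. v j * M j k') = (\<Sum>j\<in>?J. u j * M j k')"
        by (rule sum.cong) (auto simp: v_def)
      finally show ?thesis
        by (simp add: v_def algebra_simps sum_subtractf sum_distrib_left sum_distrib_right)
    qed
    have "(\<Sum>j\<in>?J. u j * ?N j k) = 0" using l by simp
    with u(2) have "\<forall>k'\<in>insert k K. (\<Sum>j\<in>J. v j * M j k') = 0"
      unfolding split by blast
    moreover have "\<exists>j\<in>J. v j \<noteq> 0" using u(1) by (auto simp: v_def)
    ultimately show ?thesis by blast
  qed
qed

section \<open>Re-expansion of multilinear polynomials at another point\<close>

text \<open>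
  The matrix of the re-expansion of multilinear polynomials: for \<open>A\<close> finite,
  \<open>\<Prod>k\<in>A. (z k - x k)\<close> has the coefficient \<open>shift_kernel (y - x) A B\<close> at \<open>\<Prod>k\<in>B. (z k - y k)\<close>.
\<close>

definition shift_kernel :: "('k \<Rightarrow> 'f::field) \<Rightarrow> 'k set \<Rightarrow> 'k set \<Rightarrow> 'f" where
  "shift_kernel \<delta> A B = (if B \<subseteq> A then \<Prod>k\<in>A - B. \<delta> k else 0)"

lemma shift_kernel_insert_both:
  "k \<notin> A \<Longrightarrow> k \<notin> B \<Longrightarrow> shift_kernel \<delta> (insert k A) (insert k B) = shift_kernel \<delta> A B"
proof -
  assume "k \<notin> A" "k \<notin> B"
  then have "insert k A - insert k B = A - B" "insert k B \<subseteq> insert k A \<longleftrightarrow> B \<subseteq> A" by auto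
  then show ?thesis by (simp add: shift_kernel_def)
qed

lemma shift_kernel_insert_left:
  assumes "finite A" "k \<notin> A" "k \<notin> B"
  shows "shift_kernel \<delta> (insert k A) B = \<delta> k * shift_kernel \<delta> A B"
proof -
  have "insert k A - B = insert k (A - B)" "B \<subseteq> insert k A \<longleftrightarrow> B \<subseteq> A" using assms by auto
  then show ?thesis using assms by (simp add: shift_kernel_def)
qed

lemma shift_kernel_insert_right:
  "k \<notin> A \<Longrightarrow> shift_kernel \<delta> A (insert k B) = 0"
  by (simp add: shift_kernel_def)

lemma sum_Pow_insert:
  assumes "finite S" "k \<notin> S"
  shows "(\<Sum>A\<in>Pow (insert k S). f A) = (\<Sum>A\<in>Pow S. f A) + (\<Sum>A\<in>Pow S. f (insert k A))"
proof -
  have inj: "inj_on (insert k) (Pow S)" using assms by (auto simp: inj_on_def)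
  have "Pow S \<inter> insert k ` Pow S = {}" using assms by auto
  then show ?thesis using assms inj
    by (simp add: Pow_insert sum.union_disjoint sum.reindex)
qed

lemma Pow_insertE:
  assumes "A \<subseteq> insert k S"
  obtains "A \<subseteq> S" "k \<notin> A" | A' where "A' \<subseteq> S" "A = insert k A'" "k \<notin> A'"
proof (cases "k \<in> A")
  case True
  then show ?thesis using assms that(2)[of "A - {k}"] by blast
next
  case False
  then show ?thesis using assms that(1) by blast
qed

text \<open>Re-expanding via an intermediate point is the same as re-expanding directly. Each
  coordinate contributes an independent factor, hence the induction on \<open>S\<close>.\<close>

lemma shift_kernel_compose:
  assumes "finite S" "A \<subseteq> S" "B \<subseteq> S"
  shows "(\<Sum>C\<in>Pow S. shift_kernel \<epsilon> A C * shift_kernel \<delta> C B)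
    = shift_kernel (\<lambda>k. \<epsilon> k + \<delta> k) A B"
  using assms
proof (induction S arbitrary: A B rule: finite_induct)
  case empty
  then show ?case by (simp add: shift_kernel_def)
next
  case (insert k S)
  have fin: "finite C" if "C \<in> Pow S" for C using that insert.hyps finite_subset by blast
  have nk: "k \<notin> C" if "C \<in> Pow S" for C using that insert.hyps by blast
  note ker = shift_kernel_insert_both shift_kernel_insert_left shift_kernel_insert_right fin nk
  from insert.prems(1) show ?case
  proof (cases rule: Pow_insertE)
    case A: 1
    from insert.prems(2) show ?thesis
    proof (cases rule: Pow_insertE)
      case B: 1
      then show ?thesis using insert.IH[of A B] insert.hyps A
        by (simp add: sum_Pow_insert ker)
    next
      case B: (2 B')
      then show ?thesis using insert.hyps A
        by (simp add: sum_Pow_insert ker)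
    qed
  next
    case A: (2 A')
    then have A': "A' \<in> Pow S" by simp
    from insert.prems(2) show ?thesis
    proof (cases rule: Pow_insertE)
      case B: 1
      then have "(\<Sum>C\<in>Pow (insert k S). shift_kernel \<epsilon> A C * shift_kernel \<delta> C B)
        = \<epsilon> k * (\<Sum>C\<in>Pow S. shift_kernel \<epsilon> A' C * shift_kernel \<delta> C B)
          + \<delta> k * (\<Sum>C\<in>Pow S. shift_kernel \<epsilon> A' C * shift_kernel \<delta> C B)"
        using insert.hyps A A'
        by (simp add: sum_Pow_insert ker sum_distrib_left mult_ac)
      also have "\<dots> = shift_kernel (\<lambda>k. \<epsilon> k + \<delta> k) A B"
        using A A' B insert.IH[of A' B] by (simp add: ker algebra_simps)
      finally show ?thesis .
    next
      case B: (2 B')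
      then show ?thesis using insert.hyps A A' insert.IH[of A' B']
        by (simp add: sum_Pow_insert ker)
    qed
  qed
qed

section \<open>Vanishing at two points\<close>

text \<open>
  A multilinear polynomial vanishing to weighted order \<open>p\<close> at one point and \<open>q\<close> at another one,
  differing from the first in all coordinates, is zero if \<open>p + q\<close> exceeds the total weight.
\<close>

lemma two_point_vanishing:
  fixes w :: "'k \<Rightarrow> int" and \<delta> :: "'k \<Rightarrow> 'f::field"
  assumes "finite E" "\<And>k. k \<in> E \<Longrightarrow> \<delta> k \<noteq> 0"
    and "\<And>A. A \<subseteq> E \<Longrightarrow> c A \<noteq> 0 \<Longrightarrow> p \<le> sum w A"
    and "\<And>B. B \<subseteq> E \<Longrightarrow> (\<Sum>A\<in>Pow E. c A * shift_kernel \<delta> A B) \<noteq> 0 \<Longrightarrow> q \<le> sum w B"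
    and "sum w E < p + q"
    and "\<And>k. k \<in> E \<Longrightarrow> 0 \<le> w k"
    and "A \<subseteq> E"
  shows "c A = 0"
  using assms
proof (induction E arbitrary: c p q A rule: finite_induct)
  case empty
  show ?case
  proof (rule ccontr)
    assume "c A \<noteq> 0"
    then have "p \<le> 0" "q \<le> 0" using empty.prems(2)[of "{}"] empty.prems(3)[of "{}"] empty.prems(6)
      by (auto simp: shift_kernel_def)
    then show False using empty.prems by simp
  qed
next
  case (insert k E)
  have fin: "finite C" if "C \<in> Pow E" for C using that insert.hyps finite_subset by blast
  have nk: "k \<notin> C" if "C \<in> Pow E" for C using that insert.hyps by blast
  note ker = shift_kernel_insert_both shift_kernel_insert_left shift_kernel_insert_right fin nk
  have \<delta>: "\<delta> l \<noteq> 0" if "l \<in> E" for l using that insert.prems by simp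
  have \<delta>k: "\<delta> k \<noteq> 0" using insert.prems by simp
  have w: "0 \<le> w l" if "l \<in> E" for l using that insert.prems by simp
  have wk: "0 \<le> w k" using insert.prems by simp
  have lt: "sum w E < p - w k + q" "sum w E < p + (q - w k)" using insert.prems insert.hyps by auto
  have low: "p \<le> sum w C" if "C \<subseteq> E" "c C \<noteq> 0" for C
    using that insert.prems(2)[of C] by auto
  have high: "p - w k \<le> sum w C" if "C \<subseteq> E" "c (insert k C) \<noteq> 0" for C
    using that insert.prems(2)[of "insert k C"] fin[of C] nk[of C]
    by (auto simp: subset_insertI2)
  \<comment> \<open>\<open>g\<close> is the restriction of the polynomial to the hyperplane where
    coordinate \<open>k\<close> has its value at the second point. It keeps order \<open>q\<close>
    there and loses at most \<open>w k\<close> at the first point.\<close>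
  define g where "g C = c C + \<delta> k * c (insert k C)" for C
  have g0: "g C = 0" if "C \<subseteq> E" for C
  proof (rule insert.IH[of g "p - w k" q, OF \<delta> _ _ lt(1) w that])
    fix C assume C: "C \<subseteq> E" "g C \<noteq> 0"
    then have "c C \<noteq> 0 \<or> c (insert k C) \<noteq> 0" by (auto simp: g_def)
    then show "p - w k \<le> sum w C" using low[OF C(1)] high[OF C(1)] wk by auto
  next
    fix B assume B: "B \<subseteq> E" "(\<Sum>A\<in>Pow E. g A * shift_kernel \<delta> A B) \<noteq> 0"
    have "(\<Sum>A\<in>Pow (insert k E). c A * shift_kernel \<delta> A B) = (\<Sum>A\<in>Pow E. g A * shift_kernel \<delta> A B)"
      using B insert.hyps by (simp add: sum_Pow_insert ker g_def algebra_simps sum.distrib)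
    then show "q \<le> sum w B" using insert.prems(3)[of B] B by auto
  qed
  \<comment> \<open>As \<open>g\<close> is zero, the polynomial is a linear factor vanishing at the
    second point times its derivative in direction \<open>k\<close>. So the derivative has order
    \<open>p\<close> at the first point and loses only \<open>w k\<close> at the second.\<close>
  have c1: "c (insert k C) = 0" if "C \<subseteq> E" for C
  proof (rule insert.IH[of "\<lambda>C. c (insert k C)" p "q - w k", OF \<delta> _ _ lt(2) w that])
    fix C assume C: "C \<subseteq> E" "c (insert k C) \<noteq> 0"
    then have "c C \<noteq> 0" using g0[of C] \<delta>k by (auto simp: g_def)
    then show "p \<le> sum w C" using low[OF C(1)] by blast
  next
    fix B assume B: "B \<subseteq> E" "(\<Sum>A\<in>Pow E. c (insert k A) * shift_kernel \<delta> A B) \<noteq> 0"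
    have "(\<Sum>A\<in>Pow (insert k E). c A * shift_kernel \<delta> A (insert k B))
      = (\<Sum>A\<in>Pow E. c (insert k A) * shift_kernel \<delta> A B)"
      using B insert.hyps by (simp add: sum_Pow_insert ker)
    then show "q - w k \<le> sum w B"
      using insert.prems(3)[of "insert k B"] B fin[of B] nk[of B]
      by (auto simp: subset_insertI2)
  qed
  have c0: "c C = 0" if "C \<subseteq> E" for C using g0[OF that] c1[OF that] by (simp add: g_def)
  from insert.prems(6) show ?case
    by (cases rule: Pow_insertE) (use c0 c1 in auto)
qed

text \<open>A coordinate in which the two points agree cannot be dropped, as its factor would be
  zero. So terms with a fixed trace \<open>C\<close> outside \<open>E\<close> are re-expanded among
  themselves, and on \<open>E\<close> all differences may be assumed nonzero.\<close>

lemma sum_shift_kernel_restrict: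
  assumes "finite S" "E \<subseteq> S" "\<And>k. k \<in> S - E \<Longrightarrow> \<delta> k = 0" "C \<subseteq> S - E" "B \<subseteq> E"
  shows "(\<Sum>A\<in>Pow S. c A * shift_kernel \<delta> A (C \<union> B))
    = (\<Sum>A\<in>Pow E. c (C \<union> A) * shift_kernel \<delta> A B)"
proof -
  have inj: "inj_on ((\<union>) C) (Pow E)" using assms(4) by (auto simp: inj_on_def)
  have "(\<Sum>A\<in>Pow S. c A * shift_kernel \<delta> A (C \<union> B))
    = (\<Sum>A\<in>(\<union>) C ` Pow E. c A * shift_kernel \<delta> A (C \<union> B))"
  proof (rule sum.mono_neutral_right)
    show "\<forall>A\<in>Pow S - (\<union>) C ` Pow E. c A * shift_kernel \<delta> A (C \<union> B) = 0"
    proof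
      fix A assume A: "A \<in> Pow S - (\<union>) C ` Pow E"
      show "c A * shift_kernel \<delta> A (C \<union> B) = 0"
      proof (cases "C \<union> B \<subseteq> A")
        case True
        have "\<exists>k\<in>A - (C \<union> B). k \<notin> E"
        proof (rule ccontr)
          assume "\<not> ?thesis"
          then have "A = C \<union> (A \<inter> E)" using True assms by blast
          then show False using A by blast
        qed
        then obtain k where "k \<in> A - (C \<union> B)" "\<delta> k = 0" using A assms(3) by blast
        moreover have "finite (A - (C \<union> B))" using A assms(1) finite_subset by blast
        ultimately show ?thesis by (simp add: shift_kernel_def prod_zero_iff) blast
      qed (auto simp: shift_kernel_def)
    qed
  qed (use assms in auto)
  also have "\<dots> = (\<Sum>A\<in>Pow E. c (C \<union> A) * shift_kernel \<delta> (C \<union> A) (C \<union> B))"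
    using inj by (simp add: sum.reindex)
  also have "\<dots> = (\<Sum>A\<in>Pow E. c (C \<union> A) * shift_kernel \<delta> A B)"
  proof (rule sum.cong)
    fix A assume A: "A \<in> Pow E"
    have "(C \<union> A) - (C \<union> B) = A - B" "C \<union> B \<subseteq> C \<union> A \<longleftrightarrow> B \<subseteq> A" using A assms by auto
    then show "c (C \<union> A) * shift_kernel \<delta> (C \<union> A) (C \<union> B) = c (C \<union> A) * shift_kernel \<delta> A B"
      by (simp add: shift_kernel_def)
  qed simp
  finally show ?thesis .
qed

section \<open>Counting heavy sets of coordinates\<close>

lemma obtain_rank:
  fixes E :: "nat set"
  assumes "finite E" "t < card E"
  obtains r where "r \<in> E" "card (E \<inter> {..<r}) = t"
proof -
  let ?P = "\<lambda>r. t < card (E \<inter> {..r})"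
  have "E \<inter> {..Max E} = E" using assms by auto
  then have ex: "?P (Max E)" using assms by simp
  define r where "r = (LEAST r. ?P r)"
  have r: "?P r" unfolding r_def by (rule LeastI[of ?P, OF ex])
  have least: "\<not> ?P s" if "s < r" for s using not_less_Least[of s ?P] that unfolding r_def by blast
  have le: "card (E \<inter> {..<r}) \<le> t"
  proof (cases r)
    case (Suc s)
    then show ?thesis using least[of s] by (simp add: lessThan_Suc_atMost)
  qed simp
  have "r \<in> E"
  proof (rule ccontr)
    assume "r \<notin> E"
    then have "E \<inter> {..r} = E \<inter> {..<r}" by (auto simp: order.order_iff_strict)
    then show False using r le by simp
  qed
  then have "E \<inter> {..r} = insert r (E \<inter> {..<r})" by auto
  then have "card (E \<inter> {..r}) = Suc (card (E \<inter> {..<r}))" using assms by simp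
  then show ?thesis using r le that \<open>r \<in> E\<close> by simp
qed

text \<open>
  The perturbation \<open>2 ^ k\<close> of the constant weight \<open>2 ^ n\<close> excludes ties between complementary
  sets of coordinates. If the \<open>t\<close> smallest coordinates are fixed, the weights of complementary
  sets among the others differ by more than what these \<open>t\<close> perturbations add up to.
\<close>

definition coord_weight :: "nat \<Rightarrow> nat \<Rightarrow> int" where
  "coord_weight n k = 2 ^ n - 2 ^ k"

text \<open>Let \<open>A\<close> contain the \<open>t\<close> smallest elements \<open>L\<close> of
  \<open>E\<close>. They add \<open>2 ^ n * t\<close>, up to small perturbations, to the surplus of
  \<open>A \<inter> E\<close> over \<open>E - A\<close>. For at least half of these \<open>A\<close>
  the rest of \<open>E\<close> adds enough to outweigh the perturbations.\<close>

lemma card_heavy_subsets: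
  assumes E: "E \<subseteq> {..<n}" and t: "t < card E"
  shows "2 ^ (n - t - 1) \<le> card {A \<in> Pow {..<n}.
    sum (coord_weight n) E + 2 ^ n * int t < 2 * sum (coord_weight n) (A \<inter> E)}"
    (is "_ \<le> card ?H")
proof -
  let ?w = "sum (coord_weight n)"
  have finE: "finite E" using E finite_subset by blast
  obtain r where r: "r \<in> E" "card (E \<inter> {..<r}) = t" using obtain_rank[OF finE t] by blast
  define L where "L = E \<inter> {..<r}"
  define R where "R = E - L"
  have finL: "finite L" and finR: "finite R" using finE by (auto simp: L_def R_def)
  have rn: "r < n" using r E by auto
  have Rr: "r \<le> k" "k < n" if "k \<in> R" for k using that E by (auto simp: R_def L_def)
  have rR: "r \<in> R" using r by (auto simp: R_def L_def)
  have dvd: "2 ^ r dvd ?w C" if "C \<subseteq> R" for C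
  proof (rule dvd_sum)
    fix k assume "k \<in> C"
    then have "r \<le> k" using that Rr by blast
    then show "2 ^ r dvd coord_weight n k"
      unfolding coord_weight_def using rn by (intro dvd_diff le_imp_power_dvd) auto
  qed
  \<comment> \<open>As \<open>r < n\<close>, the weight of \<open>r\<close> is an odd multiple of
    \<open>2 ^ r\<close>; the other weights in \<open>R\<close> are multiples of
    \<open>2 ^ Suc r\<close>. A tie would make the total twice a multiple of
    \<open>2 ^ r\<close>.\<close>
  have R_ndvd: "\<not> 2 ^ Suc r dvd ?w R"
  proof
    assume *: "2 ^ Suc r dvd ?w R"
    have "2 ^ Suc r dvd ?w (R - {r})"
    proof (rule dvd_sum)
      fix k assume "k \<in> R - {r}"
      then have "Suc r \<le> k" "k < n" using Rr[of k] by auto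
      then show "2 ^ Suc r dvd coord_weight n k"
        unfolding coord_weight_def by (intro dvd_diff le_imp_power_dvd) auto
    qed
    moreover have "?w R = coord_weight n r + ?w (R - {r})" using rR finR by (simp add: sum.remove)
    ultimately have "2 ^ Suc r dvd coord_weight n r" using * dvd_add_left_iff by metis
    moreover have "(2::int) ^ Suc r dvd 2 ^ n" using rn by (intro le_imp_power_dvd) simp
    ultimately have "(2::int) ^ Suc r dvd 2 ^ r"
      unfolding coord_weight_def by (metis dvd_diff diff_diff_eq2 add_diff_cancel_left')
    then show False by (simp add: zdvd_not_zless)
  qed
  have splitR: "?w R = ?w (R \<inter> C) + ?w (R - C)" for C
    using finR by (metis sum.Int_Diff)
  have no_tie: "?w (R \<inter> C) \<noteq> ?w (R - C)" for C
  proof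
    assume "?w (R \<inter> C) = ?w (R - C)"
    then have "?w R = 2 * ?w (R - C)" using splitR[of C] by simp
    then show False using R_ndvd dvd[of "R - C"] by simp
  qed
  \<comment> \<open>A positive multiple of \<open>2 ^ r\<close> exceeds the perturbations in
    \<open>L\<close>, whose exponents are distinct and below \<open>r\<close>.\<close>
  have gap: "2 ^ r \<le> ?w (R \<inter> C) - ?w (R - C)" if "?w (R - C) < ?w (R \<inter> C)" for C
    using that dvd[of "R \<inter> C"] dvd[of "R - C"] by (intro zdvd_imp_le dvd_diff) auto
  have "(\<Sum>k\<in>L. (2::int) ^ k) \<le> (\<Sum>k<r. 2 ^ k)"
    by (rule sum_mono2) (auto simp: L_def)
  also have "\<dots> < 2 ^ r" by (induction r) auto
  finally have L_small: "(\<Sum>k\<in>L. (2::int) ^ k) < 2 ^ r" .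
  have wL: "?w L = 2 ^ n * int t - (\<Sum>k\<in>L. 2 ^ k)"
    using r(2) by (simp add: coord_weight_def sum_subtractf L_def)
  let ?U = "{..<n} - L"
  define F where "F = {C \<in> Pow ?U. ?w (R - C) < ?w (R \<inter> C)}"
  \<comment> \<open>Complementing inside \<open>R\<close> exchanges the two weights, so without ties
    \<open>C\<close> or \<open>flip C\<close> lies in \<open>F\<close>.\<close>
  define flip where "flip C = (C - R) \<union> (R - C)" for C
  have RU: "R \<subseteq> ?U" using E by (auto simp: R_def)
  have flip_flip: "flip (flip C) = C" for C by (auto simp: flip_def)
  have "Pow ?U \<subseteq> F \<union> flip ` F"
  proof
    fix C assume C: "C \<in> Pow ?U"
    show "C \<in> F \<union> flip ` F"
    proof (cases "C \<in> F")
      case False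
      have eq: "R - flip C = R \<inter> C" "R \<inter> flip C = R - C" by (auto simp: flip_def)
      have "flip C \<in> Pow ?U" using C RU by (auto simp: flip_def)
      moreover have "?w (R - flip C) < ?w (R \<inter> flip C)"
        using False C no_tie[of C] unfolding eq F_def by auto
      ultimately have "flip C \<in> F" by (simp add: F_def)
      then show ?thesis by (metis UnI2 flip_flip imageI)
    qed simp
  qed
  have finF: "finite F" by (rule finite_subset[of _ "Pow ?U"]) (auto simp: F_def)
  have "2 ^ (n - t) = card (Pow ?U)"
    using E r(2) finL by (simp add: card_Pow card_Diff_subset L_def)
      (subst card_Diff_subset, auto)
  also have "\<dots> \<le> card (F \<union> flip ` F)" using finF \<open>Pow ?U \<subseteq> _\<close> by (intro card_mono) auto
  also have "\<dots> \<le> card F + card F"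
    using card_Un_le[of F "flip ` F"] card_image_le[OF finF, of flip] by linarith
  finally have "2 ^ (n - t) \<le> 2 * card F" by simp
  moreover have "t < n" using t card_mono[OF _ E] by simp
  then have "(2::nat) ^ (n - t) = 2 * 2 ^ (n - t - 1)" by (simp flip: power_Suc)
  ultimately have "2 ^ (n - t - 1) \<le> card F" by simp
  also have "card F = card ((\<union>) L ` F)"
    by (rule card_image[symmetric]) (auto simp: inj_on_def F_def)
  also have "\<dots> \<le> card ?H"
  proof (rule card_mono)
    show "(\<union>) L ` F \<subseteq> ?H"
    proof
      fix A assume "A \<in> (\<union>) L ` F"
      then obtain C where C: "C \<in> F" "A = L \<union> C" by blast
      have AE: "A \<inter> E = L \<union> (R \<inter> C)" "L \<inter> (R \<inter> C) = {}"
        using C by (auto simp: F_def R_def L_def)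
      have "?w (A \<inter> E) = ?w L + ?w (R \<inter> C)" unfolding AE(1)
        using AE(2) finL finR by (simp add: sum.union_disjoint)
      moreover have "?w E = ?w L + ?w R"
        using finE by (simp add: R_def L_def sum.subset_diff[of "E \<inter> {..<r}" E])
      moreover have "2 ^ r \<le> ?w (R \<inter> C) - ?w (R - C)" using C gap by (simp add: F_def)
      moreover have "A \<subseteq> {..<n}" using C E by (auto simp: F_def L_def)
      ultimately show "A \<in> ?H" using splitR[of C] wL L_small by simp
    qed
  qed simp
  finally show ?thesis .
qed

section \<open>Bound on the number of pairs of points\<close>

lemma card_cross_family_le:
  fixes x y :: "'i \<Rightarrow> nat \<Rightarrow> 'f::field"
  assumes finI: "finite I"
    and far: "\<And>i. i \<in> I \<Longrightarrow> t < hamming_dist n (x i) (y i)"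
    and near: "\<And>i j. i \<in> I \<Longrightarrow> j \<in> I \<Longrightarrow> i \<noteq> j \<Longrightarrow> hamming_dist n (x i) (y j) \<le> t"
  shows "card I \<le> 2 ^ (t + 1)"
proof (rule ccontr)
  assume big: "\<not> card I \<le> 2 ^ (t + 1)"
  let ?S = "{..<n}"
  let ?w = "sum (coord_weight n)"
  let ?T = "\<lambda>c \<delta> B. \<Sum>A\<in>Pow ?S. c A * shift_kernel \<delta> A B"
  define E where "E i = {k \<in> ?S. x i k \<noteq> y i k}" for i
  define H where "H i = {A \<in> Pow ?S. ?w (E i) + 2 ^ n * int t < 2 * ?w (A \<inter> E i)}" for i
  have cE: "t < card (E i)" if "i \<in> I" for i
    using far[OF that] by (simp add: hamming_dist_def E_def)
  have finH: "finite (H i)" for i by (simp add: H_def)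
  from big have "I \<noteq> {}" by auto
  then obtain i0 where "i0 \<in> I" by blast
  moreover have "card (E i0) \<le> card ?S" by (rule card_mono) (auto simp: E_def)
  ultimately have tn: "t < n" using cE[of i0] by simp
  have "2 ^ n = 2 ^ (t + 1) * (2::nat) ^ (n - t - 1)"
    using tn by (simp flip: power_add power_Suc)
  also have "\<dots> < card I * 2 ^ (n - t - 1)" using big by simp
  also have "\<dots> = (\<Sum>i\<in>I. 2 ^ (n - t - 1))" by simp
  also have "\<dots> \<le> (\<Sum>i\<in>I. card (H i))"
    unfolding H_def by (intro sum_mono card_heavy_subsets cE) (auto simp: E_def)
  also have "\<dots> = card (Sigma I H)" using finI finH by (simp add: card_SigmaI)
  finally have "card (Pow ?S) < card (Sigma I H)" by (simp add: card_Pow)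
  \<comment> \<open>More polynomials than monomials: the shift by \<open>- x i\<close> expands
    everything at the origin, and each monomial gives one equation.\<close>
  then obtain u where u: "\<exists>j\<in>Sigma I H. u j \<noteq> 0"
    "\<forall>B\<in>Pow ?S. (\<Sum>j\<in>Sigma I H. u j * (\<lambda>(i, A). shift_kernel (\<lambda>k. - x i k) A) j B) = 0"
    using homogeneous_system_solution[of "Pow ?S" "Sigma I H"] finI finH by blast
  define c where "c i A = (if A \<in> H i then u (i, A) else 0)" for i A
  have cH: "A \<in> H i" if "c i A \<noteq> 0" for i A using that by (simp add: c_def split: if_splits)
  have zero: "(\<Sum>i\<in>I. ?T (c i) (\<lambda>k. - x i k) B) = 0" if B: "B \<in> Pow ?S" for B
  proof -
    have "(\<Sum>i\<in>I. ?T (c i) (\<lambda>k. - x i k) B)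
      = (\<Sum>i\<in>I. \<Sum>A\<in>H i. u (i, A) * shift_kernel (\<lambda>k. - x i k) A B)"
      by (intro sum.cong sum.mono_neutral_cong_right) (auto simp: c_def H_def)
    also have "\<dots> = (\<Sum>j\<in>Sigma I H. u j * (\<lambda>(i, A). shift_kernel (\<lambda>k. - x i k) A) j B)"
      using finI finH by (simp add: sum.Sigma case_prod_unfold)
    finally show ?thesis using u(2) B by simp
  qed
  \<comment> \<open>The relation is one between polynomials, so it persists in the expansion at any
    point \<open>v\<close>.\<close>
  have zero': "(\<Sum>i\<in>I. ?T (c i) (\<lambda>k. v k - x i k) B) = 0" if B: "B \<in> Pow ?S" for B v
  proof -
    have "(\<Sum>i\<in>I. ?T (c i) (\<lambda>k. v k - x i k) B)
      = (\<Sum>i\<in>I. \<Sum>A\<in>Pow ?S. \<Sum>C\<in>Pow ?S.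
          c i A * (shift_kernel (\<lambda>k. - x i k) A C * shift_kernel v C B))"
    proof (intro sum.cong refl)
      fix i A assume "A \<in> Pow ?S"
      then show "c i A * shift_kernel (\<lambda>k. v k - x i k) A B
        = (\<Sum>C\<in>Pow ?S. c i A * (shift_kernel (\<lambda>k. - x i k) A C * shift_kernel v C B))"
        using shift_kernel_compose[of ?S A B "\<lambda>k. - x i k" v] B by (simp flip: sum_distrib_left)
    qed
    also have "\<dots> = (\<Sum>i\<in>I. \<Sum>C\<in>Pow ?S. \<Sum>A\<in>Pow ?S.
          c i A * (shift_kernel (\<lambda>k. - x i k) A C * shift_kernel v C B))"
      by (rule sum.cong[OF refl]) (rule sum.swap)
    also have "\<dots> = (\<Sum>C\<in>Pow ?S. \<Sum>i\<in>I. \<Sum>A\<in>Pow ?S.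
          c i A * (shift_kernel (\<lambda>k. - x i k) A C * shift_kernel v C B))"
      by (rule sum.swap)
    also have "\<dots> = (\<Sum>C\<in>Pow ?S. (\<Sum>i\<in>I. ?T (c i) (\<lambda>k. - x i k) C) * shift_kernel v C B)"
      by (simp add: sum_distrib_right mult.assoc)
    also have "\<dots> = 0" using zero by simp
    finally show ?thesis .
  qed
  let ?supp = "{(i, A). i \<in> I \<and> A \<in> Pow ?S \<and> c i A \<noteq> 0}"
  have "?supp \<subseteq> I \<times> Pow ?S" by auto
  then have fsupp: "finite ?supp" using finI by (meson finite_SigmaI finite_Pow_iff finite_lessThan finite_subset)
  moreover have "?supp \<noteq> {}" using u(1) by (auto simp: c_def H_def)
  ultimately obtain m where m: "is_arg_min (\<lambda>(i, A). ?w A) (\<lambda>z. z \<in> ?supp) m"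
    using ex_is_arg_min_if_finite by blast
  obtain j A0 where m_eq: "m = (j, A0)" by (cases m)
  have j: "j \<in> I" "A0 \<subseteq> ?S" "c j A0 \<noteq> 0"
    using m m_eq by (auto simp: is_arg_min_def)
  have min: "?w A0 \<le> ?w A" if "i \<in> I" "A \<subseteq> ?S" "c i A \<noteq> 0" for i A
    using m that unfolding m_eq is_arg_min_linorder by auto
  let ?\<delta> = "\<lambda>k. y j k - x j k"
  \<comment> \<open>At \<open>y j\<close> the term of index \<open>j\<close> is minus the sum of the
    others. In these, re-expansion drops only coordinates where \<open>x i\<close> and
    \<open>y j\<close> differ: at most \<open>t\<close>, each of weight at most
    \<open>2 ^ n\<close>.\<close>
  have order_y: "?w A0 - 2 ^ n * int t \<le> ?w B"
    if B: "B \<subseteq> ?S" and nz: "?T (c j) ?\<delta> B \<noteq> 0" for B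
  proof -
    have "?T (c j) ?\<delta> B + (\<Sum>i\<in>I - {j}. ?T (c i) (\<lambda>k. y j k - x i k) B) = 0"
      using zero'[of B "y j"] B j finI by (simp add: sum.remove)
    then have "(\<Sum>i\<in>I - {j}. ?T (c i) (\<lambda>k. y j k - x i k) B) \<noteq> 0" using nz by auto
    then obtain i where i: "i \<in> I - {j}" "?T (c i) (\<lambda>k. y j k - x i k) B \<noteq> 0"
      by (meson sum.not_neutral_contains_not_neutral)
    then obtain A where A: "A \<in> Pow ?S" "c i A * shift_kernel (\<lambda>k. y j k - x i k) A B \<noteq> 0"
      by (meson sum.not_neutral_contains_not_neutral)
    have finA: "finite A" using A finite_subset by blast
    from A have ker: "B \<subseteq> A" "(\<Prod>k\<in>A - B. y j k - x i k) \<noteq> 0" "c i A \<noteq> 0"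
      by (auto simp: shift_kernel_def split: if_splits)
    then have "\<forall>k\<in>A - B. y j k \<noteq> x i k" using finA by (simp add: prod_zero_iff)
    then have "A - B \<subseteq> {k \<in> ?S. x i k \<noteq> y j k}" using A(1) by force
    then have "card (A - B) \<le> hamming_dist n (x i) (y j)"
      unfolding hamming_dist_def by (intro card_mono) auto
    also have "\<dots> \<le> t" using near i j by auto
    finally have "card (A - B) \<le> t" .
    have "?w (A - B) \<le> (\<Sum>k\<in>A - B. 2 ^ n)"
      by (rule sum_mono) (simp add: coord_weight_def)
    also have "\<dots> \<le> 2 ^ n * int t" using \<open>card (A - B) \<le> t\<close> by simp
    finally have "?w (A - B) \<le> 2 ^ n * int t" .
    moreover have "?w A = ?w (A - B) + ?w B" using ker(1) finA by (rule sum.subset_diff)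
    moreover have "?w A0 \<le> ?w A" using min[of i A] i A ker by auto
    ultimately show ?thesis by linarith
  qed
  have Ej: "E j \<subseteq> ?S" "finite (E j)" by (auto simp: E_def)
  \<comment> \<open>Only the slice of terms agreeing with \<open>A0\<close> outside
    \<open>E j\<close> is considered. There the two orders add up to more than the weight of
    \<open>E j\<close> because \<open>A0\<close> is in \<open>H j\<close>.\<close>
  define C where "C = A0 - E j"
  have C: "C \<subseteq> ?S - E j" using j by (auto simp: C_def)
  have finC: "finite C" using C finite_subset by blast
  have union: "?w (C \<union> A) = ?w C + ?w A" if "A \<subseteq> E j" for A
    using that C finC Ej(2) by (intro sum.union_disjoint) (auto intro: finite_subset)
  have A0: "A0 = C \<union> (A0 \<inter> E j)" by (auto simp: C_def)
  then have wA0: "?w A0 = ?w C + ?w (A0 \<inter> E j)" using union[of "A0 \<inter> E j"] by simp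
  have "c j (C \<union> (A0 \<inter> E j)) = 0"
  proof (rule two_point_vanishing[of "E j" ?\<delta> "\<lambda>A. c j (C \<union> A)" "?w (A0 \<inter> E j)" "coord_weight n"
        "?w (A0 \<inter> E j) - 2 ^ n * int t"])
    fix A assume A: "A \<subseteq> E j" "c j (C \<union> A) \<noteq> 0"
    then have "?w A0 \<le> ?w (C \<union> A)" using min[OF j(1), of "C \<union> A"] C Ej by blast
    then show "?w (A0 \<inter> E j) \<le> ?w A" using wA0 union[OF A(1)] by simp
  next
    fix B assume B: "B \<subseteq> E j" "(\<Sum>A\<in>Pow (E j). c j (C \<union> A) * shift_kernel ?\<delta> A B) \<noteq> 0"
    have "?T (c j) ?\<delta> (C \<union> B) = (\<Sum>A\<in>Pow (E j). c j (C \<union> A) * shift_kernel ?\<delta> A B)"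
      by (rule sum_shift_kernel_restrict) (use Ej C B in \<open>auto simp: E_def\<close>)
    then have "?w A0 - 2 ^ n * int t \<le> ?w (C \<union> B)" using order_y[of "C \<union> B"] B C Ej by auto
    then show "?w (A0 \<inter> E j) - 2 ^ n * int t \<le> ?w B" using wA0 union[OF B(1)] by simp
  next
    show "?w (E j) < ?w (A0 \<inter> E j) + (?w (A0 \<inter> E j) - 2 ^ n * int t)"
      using cH[OF j(3)] by (simp add: H_def)
  qed (auto simp: E_def coord_weight_def)
  then show False using j(3) A0 by simp
qed

section \<open>Upper bound for the Helly number\<close>

lemma helly_property_hamming_balls:
  fixes X :: "'a set"
  shows "helly_property ((\<lambda>x. hamming_ball n X x t) ` ({..<n} \<rightarrow>\<^sub>E X)) (2 ^ (t + 1))"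
  unfolding helly_property_def
proof (intro allI impI notI)
  fix \<K> :: "(nat \<Rightarrow> 'a) set set"
  assume "\<K> \<subseteq> (\<lambda>x. hamming_ball n X x t) ` ({..<n} \<rightarrow>\<^sub>E X) \<and> finite \<K>"
    and small: "\<forall>\<G>. \<G> \<subseteq> \<K> \<and> card \<G> \<le> 2 ^ (t + 1) \<longrightarrow> \<Inter>\<G> \<noteq> {}" and empty: "\<Inter>\<K> = {}"
  then have K: "\<K> \<subseteq> (\<lambda>x. hamming_ball n X x t) ` ({..<n} \<rightarrow>\<^sub>E X)" and finK: "finite \<K>" by auto
  let ?P = "{\<L>. \<L> \<subseteq> \<K> \<and> \<Inter>\<L> = {}}"
  have "finite ?P" "\<K> \<in> ?P" using finK empty by auto
  from finite_has_minimal2[OF this] obtain I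
    where I: "I \<in> ?P" and "\<forall>\<L>\<in>?P. \<L> \<subseteq> I \<longrightarrow> I = \<L>" by (elim bexE conjE)
  then have min: "I = \<L>" if "\<L> \<in> ?P" "\<L> \<subseteq> I" for \<L>
    using that by (blast dest: bspec)
  have finI: "finite I" using I finK finite_subset by blast
  have big: "2 ^ (t + 1) < card I" using I spec[OF small, of I] by (simp add: not_le[symmetric])
  have "\<exists>y. y \<in> \<Inter>(I - {b})" if "b \<in> I" for b
  proof (rule ccontr)
    assume "\<not> ?thesis"
    then have "I - {b} \<in> ?P" using I by auto
    then show False using min[of "I - {b}"] that by blast
  qed
  then obtain y where y: "\<And>b. b \<in> I \<Longrightarrow> y b \<in> \<Inter>(I - {b})" by metis
  have "\<exists>x. x \<in> {..<n} \<rightarrow>\<^sub>E X \<and> b = hamming_ball n X x t" if "b \<in> I" for b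
    using that I K by blast
  then obtain x where x: "\<And>b. b \<in> I \<Longrightarrow> x b \<in> {..<n} \<rightarrow>\<^sub>E X \<and> b = hamming_ball n X (x b) t"
    by metis
  have y_out: "y b \<notin> b" if "b \<in> I" for b
  proof
    assume "y b \<in> b"
    then have "y b \<in> \<Inter>I" using y[OF that] by blast
    then show False using I by blast
  qed
  \<comment> \<open>If \<open>I\<close> were \<open>{b}\<close>, then
    \<open>\<Inter>(I - {b})\<close> would be \<open>UNIV\<close> and say nothing about
    \<open>y b\<close>; \<open>big\<close> excludes this.\<close>
  have y_mem: "y b \<in> {..<n} \<rightarrow>\<^sub>E X" if b: "b \<in> I" for b
  proof -
    have "I \<noteq> {b}"
    proof
      assume "I = {b}"
      then show False using big by simp
    qed
    then obtain b' where "b' \<in> I - {b}" using b by blast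
    then show ?thesis using x[of b'] y[OF b] by (auto simp: hamming_ball_def)
  qed
  \<comment> \<open>Only finitely many letters occur, so they can be encoded injectively as reals,
    which keeps all distances and makes a field available for any \<open>X\<close>.\<close>
  define Y where "Y = (\<Union>b\<in>I. x b ` {..<n} \<union> y b ` {..<n})"
  have "finite Y" using finI by (auto simp: Y_def)
  from finite_imp_inj_to_nat_seg[OF this] obtain g :: "'a \<Rightarrow> nat" where g: "inj_on g Y"
    by (elim exE conjE)
  have dist: "hamming_dist n (\<lambda>k. real (g (x b k))) (\<lambda>k. real (g (y b' k))) = hamming_dist n (y b') (x b)"
    if "b \<in> I" "b' \<in> I" for b b'
  proof -
    have "g (x b k) = g (y b' k) \<longleftrightarrow> x b k = y b' k" if "k < n" for k
      using that \<open>b \<in> I\<close> \<open>b' \<in> I\<close> by (intro inj_on_eq_iff[OF g]) (auto simp: Y_def)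
    then have "{k \<in> {..<n}. real (g (x b k)) \<noteq> real (g (y b' k))} = {k \<in> {..<n}. y b' k \<noteq> x b k}"
      by auto
    then show ?thesis by (simp add: hamming_dist_def)
  qed
  have "card I \<le> 2 ^ (t + 1)"
  proof (rule card_cross_family_le[OF finI])
    fix b assume b: "b \<in> I"
    then have "\<not> hamming_dist n (y b) (x b) \<le> t"
      using y_out[OF b] y_mem[OF b] x[OF b] by (auto simp: hamming_ball_def)
    then show "t < hamming_dist n (\<lambda>k. real (g (x b k))) (\<lambda>k. real (g (y b k)))"
      using dist b by simp
  next
    fix b b' assume b: "b \<in> I" "b' \<in> I" "b \<noteq> b'"
    then have "y b' \<in> b" using y[of b'] by blast
    then have "hamming_dist n (y b') (x b) \<le> t" using x[OF b(1)] by (auto simp: hamming_ball_def)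
    then show "hamming_dist n (\<lambda>k. real (g (x b k))) (\<lambda>k. real (g (y b' k))) \<le> t"
      using dist b by simp
  qed
  then show False using big by simp
qed

section \<open>Lower bound for the Helly number\<close>

text \<open>On the first \<open>t + 1\<close> coordinates, the antipode of a center is too far from
  that center only, so every proper subfamily of the balls has a common point.\<close>

lemma helly_property_hamming_balls_ge:
  fixes X :: "'a set"
  assumes "t < n" "a \<in> X" "b \<in> X" "a \<noteq> b"
    and helly: "helly_property ((\<lambda>x. hamming_ball n X x t) ` ({..<n} \<rightarrow>\<^sub>E X)) h"
  shows "2 ^ (t + 1) \<le> h"
proof (rule ccontr)
  assume h: "\<not> 2 ^ (t + 1) \<le> h"
  let ?U = "{..t}"
  define v where "v V = (\<lambda>k\<in>{..<n}. if k \<in> V then b else a)" for V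
  define ball where "ball V = hamming_ball n X (v V) t" for V
  let ?K = "ball ` Pow ?U"
  have v: "v V \<in> {..<n} \<rightarrow>\<^sub>E X" for V using assms by (auto simp: v_def)
  have anti: "v (?U - V) \<in> ball W \<longleftrightarrow> V \<noteq> W" if "V \<subseteq> ?U" "W \<subseteq> ?U" for V W
  proof -
    have "{k \<in> {..<n}. v (?U - V) k \<noteq> v W k} = {k \<in> ?U. k \<in> V \<longleftrightarrow> k \<in> W}"
      using that assms by (auto simp: v_def)
    then have "v (?U - V) \<in> ball W \<longleftrightarrow> card {k \<in> ?U. k \<in> V \<longleftrightarrow> k \<in> W} < card ?U"
      using v by (auto simp: ball_def hamming_ball_def hamming_dist_def)
    also have "\<dots> \<longleftrightarrow> V \<noteq> W"
    proof
      assume "V \<noteq> W"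
      then have "{k \<in> ?U. k \<in> V \<longleftrightarrow> k \<in> W} \<subset> ?U" using that by auto
      then show "card {k \<in> ?U. k \<in> V \<longleftrightarrow> k \<in> W} < card ?U" by (intro psubset_card_mono) auto
    qed auto
    finally show ?thesis .
  qed
  have inj: "inj_on ball (Pow ?U)" using anti by (auto intro!: inj_onI) (metis+)
  have "\<Inter>\<G> \<noteq> {}" if G: "\<G> \<subseteq> ?K" "card \<G> \<le> h" for \<G>
  proof -
    have "card \<G> < card ?K" using G h inj by (simp add: card_image card_Pow)
    then have "\<G> \<noteq> ?K" by auto
    then obtain V where V: "V \<subseteq> ?U" "ball V \<notin> \<G>" using G by blast
    have "v (?U - V) \<in> \<Inter>\<G>" using G V anti[OF V(1)] by auto
    then show ?thesis by blast
  qed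
  moreover have "?K \<subseteq> (\<lambda>x. hamming_ball n X x t) ` ({..<n} \<rightarrow>\<^sub>E X)"
    using v by (auto simp: ball_def)
  ultimately have "\<Inter>?K \<noteq> {}"
    using helly[unfolded helly_property_def, rule_format, of ?K] by simp
  then obtain p where p: "p \<in> \<Inter>?K" by blast
  \<comment> \<open>The center \<open>v ?V\<close> is chosen to differ from \<open>p\<close> in each
    of the first \<open>t + 1\<close> coordinates, even where \<open>p\<close> is neither
    \<open>a\<close> nor \<open>b\<close>.\<close>
  let ?V = "{k \<in> ?U. p k = a}"
  have "p \<in> ball ?V" using p by auto
  then have "card {k \<in> {..<n}. p k \<noteq> v ?V k} \<le> t"
    by (simp add: ball_def hamming_ball_def hamming_dist_def)
  moreover have "?U \<subseteq> {k \<in> {..<n}. p k \<noteq> v ?V k}" using assms by (auto simp: v_def)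
  then have "card ?U \<le> card {k \<in> {..<n}. p k \<noteq> v ?V k}" by (intro card_mono) auto
  ultimately show False by simp
qed

theorem theorem1p1:
  fixes n t :: nat and X :: "'a set"
  assumes "t < n"
    and "infinite X \<or> 2 \<le> card X"
  shows "hamming_helly_number n t X = enat (2 ^ (t + 1))"
proof -
  let ?F = "(\<lambda>x. hamming_ball n X x t) ` ({..<n} \<rightarrow>\<^sub>E X)"
  obtain a b where ab: "a \<in> X" "b \<in> X" "a \<noteq> b"
  proof -
    obtain Y where "Y \<subseteq> X" "card Y = 2"
      using assms(2) by (meson infinite_arbitrarily_large obtain_subset_with_card_n)
    then show ?thesis using that by (auto simp: card_2_iff)
  qed
  have "Inf (enat ` {h. helly_property ?F h}) = enat (2 ^ (t + 1))"
  proof (rule antisym)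
    show "Inf (enat ` {h. helly_property ?F h}) \<le> enat (2 ^ (t + 1))"
      using helly_property_hamming_balls by (intro Inf_lower) blast
    show "enat (2 ^ (t + 1)) \<le> Inf (enat ` {h. helly_property ?F h})"
      using helly_property_hamming_balls_ge[OF assms(1) ab] by (intro Inf_greatest) auto
  qed
  then show ?thesis by (simp add: hamming_helly_number_def helly_number_def)
qed

end
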